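(* Let $\sigma\in\mathcal{M}^+(\mathbb{R}^n)$ and $0<q<1$. Let $\{\rho_Q\}_{Q\in\mathcal{Q}}$ be a fixed family of nonnegative real numbers indexed by the family $\mathcal{Q}$ of all dyadic cubes in $\mathbb{R}^n$. Then the following conditions are equivalent: (1) There exists a positive constant $\varkappa_w$ such that $\|M_\rho\nu\|_{L^{q,\infty}(\sigma)}\le\varkappa_w\|\nu\|$ for all $\nu\in\mathcal{M}^+(\mathbb{R}^n)$. (2) $M_\rho\sigma\in L^{\frac q{1-q},\infty}(\sigma)$.
   Context: $\mathcal{M}^+(\mathbb{R}^n)$ is the class of nonnegative locally finite Borel measures on $\mathbb{R}^n$ and $\|\nu\|=\nu(\mathbb{R}^n)$. The generalized dyadic maximal operator is $M_\rho\nu(x)=\sup_{Q\in\mathcal{Q},\,Q\ni x}\rho_Q\,\nu(Q)$, $x\in\mathbb{R}^n$, where dyadic cubes are the usual half-open ones. For $0<r<\infty$, $\|f\|_{L^{r,\infty}(\sigma)}=\sup_{t>0}t\,\sigma(\{x:|f(x)|>t\})^{1/r}$, and $L^{r,\infty}(\sigma)$ consists of the $f$ for which this is finite. *)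

theory Defs
  imports "HOL-Analysis.Analysis"
begin

definition locally_finite_borel_measures :: "('a::topological_space) measure set" where
  "locally_finite_borel_measures =
     {\<nu>. sets \<nu> = sets borel \<and> (\<forall>x. \<exists>U. open U \<and> x \<in> U \<and> emeasure \<nu> U < \<infinity>)}"

definition dyadic_cube :: "int \<Rightarrow> int ^ 'n \<Rightarrow> (real ^ 'n) set" where
  "dyadic_cube k m =
     {x. \<forall>i. 2 powi k * real_of_int (m $ i) \<le> x $ i \<and> x $ i < 2 powi k * (real_of_int (m $ i) + 1)}"

text \<open>Side lengths range over all integer powers of 2, both small and large.\<close>

definition dyadic_cubes :: "(real ^ 'n) set set" where
  "dyadic_cubes = {dyadic_cube k m | k m. True}"

text \<open>The maximal function may be infinite, so it takes values in \<^typ>\<open>ennreal\<close>; only the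
  values of the weight on dyadic cubes matter, and these are nonnegative in all uses.\<close>

definition dyadic_maximal ::
    "((real ^ 'n) set \<Rightarrow> real) \<Rightarrow> (real ^ 'n) measure \<Rightarrow> real ^ 'n \<Rightarrow> ennreal" where
  "dyadic_maximal \<rho> \<nu> x = (SUP Q \<in> {Q \<in> dyadic_cubes. x \<in> Q}. ennreal (\<rho> Q) * emeasure \<nu> Q)"

text \<open>Power with a positive exponent on \<open>[0, \<infinity>]\<close>, with value \<open>\<infinity>\<close> at \<open>\<infinity>\<close>.\<close>

definition ennreal_rpow :: "ennreal \<Rightarrow> real \<Rightarrow> ennreal" where
  "ennreal_rpow a p = (if a = \<infinity> then \<infinity> else ennreal (enn2real a powr p))"

definition weak_Lp_norm :: "real \<Rightarrow> 'a measure \<Rightarrow> ('a \<Rightarrow> ennreal) \<Rightarrow> ennreal" where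
  "weak_Lp_norm r \<sigma> f =
     (SUP t \<in> {0<..}. ennreal t * ennreal_rpow (emeasure \<sigma> {x \<in> space \<sigma>. f x > ennreal t}) (1 / r))"

text \<open>The requirement of measurability is automatic for \<^const>\<open>dyadic_maximal\<close>; see below.\<close>

definition weak_Lp :: "real \<Rightarrow> 'a measure \<Rightarrow> ('a \<Rightarrow> ennreal) set" where
  "weak_Lp r \<sigma> = {f \<in> borel_measurable \<sigma>. weak_Lp_norm r \<sigma> f < \<infinity>}"

lemma countable_dyadic_cubes: "countable (dyadic_cubes :: (real ^ 'n) set set)"
proof -
  have "inj (\<lambda>(m :: int ^ 'n) i. m $ i)"
    by (auto simp: inj_def vec_eq_iff fun_eq_iff)
  moreover have "countable (UNIV :: ('n \<Rightarrow> int) set)"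
    by simp
  ultimately have "countable (UNIV :: (int ^ 'n) set)"
    by (metis countable_image_inj_on countable_subset subset_UNIV)
  then have "countable ((\<lambda>(k, m :: int ^ 'n). dyadic_cube k m) ` (UNIV \<times> UNIV))"
    by (intro countable_image countable_SIGMA) auto
  moreover have "dyadic_cubes = (\<lambda>(k, m :: int ^ 'n). dyadic_cube k m) ` (UNIV \<times> UNIV)"
    by (auto simp: dyadic_cubes_def)
  ultimately show ?thesis
    by metis
qed

lemma borel_dyadic_cubes:
  assumes "Q \<in> dyadic_cubes"
  shows "Q \<in> sets borel"
proof -
  obtain k m where Q: "Q = dyadic_cube k m"
    using assms by (auto simp: dyadic_cubes_def)
  show ?thesis
    unfolding Q dyadic_cube_def by measurable
qed

lemma borel_measurable_dyadic_maximal: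
  fixes \<nu> :: "(real ^ 'n) measure"
  shows "dyadic_maximal \<rho> \<nu> \<in> borel_measurable borel"
proof -
  have "dyadic_maximal \<rho> \<nu> =
      (\<lambda>x. SUP Q \<in> dyadic_cubes. ennreal (\<rho> Q) * emeasure \<nu> Q * indicator Q x)"
    unfolding dyadic_maximal_def fun_eq_iff
    by (intro allI antisym SUP_least)
       (auto intro!: SUP_upper2 split: split_indicator simp: indicator_def)
  then show ?thesis
    using borel_dyadic_cubes
    by (auto intro!: borel_measurable_SUP countable_dyadic_cubes borel_measurable_times_ennreal
        borel_measurable_indicator)
qed

end

theory Submission
  imports Defs
begin

text \<open>Both directions rest on the fact that \<open>{M\<^sub>\<rho> \<nu> > t}\<close> is the union of the dyadic cubes \<open>Q\<close>
  with \<open>\<rho> Q * \<nu> Q > t\<close>. For (1) \<open>\<Longrightarrow>\<close> (2), let \<open>E\<close> be a finite union of cubes with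
  \<open>\<rho> Q * \<sigma> Q > t\<close> and test (1) on the restriction \<open>\<nu>\<close> of \<open>\<sigma>\<close> to \<open>E\<close>: since \<open>E\<close> is contained in
  \<open>{M\<^sub>\<rho> \<nu> > t}\<close>, this gives \<open>\<sigma> E \<le> (\<kappa> \<sigma> E / t)\<^sup>q\<close>, which can be solved for the finite number
  \<open>\<sigma> E\<close>. For (2) \<open>\<Longrightarrow>\<close> (1), fix \<open>s > 0\<close>. A cube with \<open>\<rho> Q * \<nu> Q > t\<close> either lies in
  \<open>{M\<^sub>\<rho> \<sigma> > s}\<close> or satisfies \<open>t * \<sigma> Q \<le> s * \<nu> Q\<close>; the cubes of the second kind are handled by the
  weak-type (1,1) covering argument, and one optimizes in \<open>s\<close>.\<close>

section \<open>Geometry of dyadic cubes\<close>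

text \<open>The faces of the coarse cube sit at integer multiples of the fine side length. A common
  point therefore compares integers coordinatewise, and a strict inequality between integers gains a
  full unit, which leaves room for the whole fine cube.\<close>

lemma dyadic_cube_mono:
  fixes m n :: "int ^ 'n"
  assumes "k \<le> l" and "dyadic_cube k m \<inter> dyadic_cube l n \<noteq> {}"
  shows "dyadic_cube k m \<subseteq> dyadic_cube l n"
proof
  fix y assume y: "y \<in> dyadic_cube k m"
  obtain x where x: "x \<in> dyadic_cube k m" "x \<in> dyadic_cube l n"
    using assms(2) by blast
  \<comment> \<open>\<open>D\<close> is the ratio of the two side lengths, an integer because
    \<open>k \<le> l\<close>; \<open>a\<close> is the fine side length.\<close>
  define D :: int where "D = 2 ^ nat (l - k)"
  define a :: real where "a = 2 powi k"
  have a: "a > 0"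
    by (simp add: a_def)
  have "l = k + int (nat (l - k))"
    using assms(1) by simp
  then have "(2::real) powi l = a * 2 powi (int (nat (l - k)))"
    unfolding a_def by (metis power_int_add zero_neq_numeral)
  then have powl: "(2::real) powi l = a * of_int D"
    unfolding D_def power_int_of_nat by simp
  have "2 powi l * real_of_int (n $ i) \<le> y $ i \<and> y $ i < 2 powi l * (real_of_int (n $ i) + 1)" for i
  proof -
    have x1: "a * of_int (m $ i) \<le> x $ i" "x $ i < a * (of_int (m $ i) + 1)"
      and x2: "a * of_int D * of_int (n $ i) \<le> x $ i" "x $ i < a * of_int D * (of_int (n $ i) + 1)"
      using x by (auto simp: dyadic_cube_def powl simp flip: a_def)
    have y1: "a * of_int (m $ i) \<le> y $ i" "y $ i < a * (of_int (m $ i) + 1)"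
      using y by (auto simp: dyadic_cube_def simp flip: a_def)
    \<comment> \<open>The common point \<open>x\<close> lies between the fine lower face and the
      coarse upper face; cancelling \<open>a\<close> leaves integers.\<close>
    have "a * real_of_int (m $ i) < a * of_int (D * (n $ i + 1))"
      using x1(1) x2(2) by (simp add: mult.assoc)
    then have "real_of_int (m $ i) < of_int (D * (n $ i + 1))"
      using a mult_less_cancel_left_pos by blast
    then have upper: "m $ i + 1 \<le> D * (n $ i + 1)"
      by linarith
    have "a * real_of_int (D * n $ i) < a * of_int (m $ i + 1)"
      using x1(2) x2(1) by (simp add: mult.assoc)
    then have "real_of_int (D * n $ i) < of_int (m $ i + 1)"
      using a mult_less_cancel_left_pos by blast
    then have lower: "D * n $ i \<le> m $ i"
      by linarith
    have "a * real_of_int (m $ i + 1) \<le> a * of_int (D * (n $ i + 1))"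
      using upper a by (intro mult_left_mono) (auto simp only: of_int_le_iff)
    moreover have "a * real_of_int (D * n $ i) \<le> a * of_int (m $ i)"
      using lower a by (intro mult_left_mono) (auto simp only: of_int_le_iff)
    ultimately show ?thesis
      using y1 by (simp add: powl mult.assoc)
  qed
  then show "y \<in> dyadic_cube l n"
    by (simp add: dyadic_cube_def)
qed

lemma dyadic_cubes_nested:
  assumes "P \<in> dyadic_cubes" "Q \<in> dyadic_cubes" and "P \<inter> Q \<noteq> {}"
  shows "P \<subseteq> Q \<or> Q \<subseteq> P"
proof -
  obtain k m l n where "P = dyadic_cube k m" "Q = dyadic_cube l n"
    using assms by (auto simp: dyadic_cubes_def)
  then show ?thesis
    using assms(3) dyadic_cube_mono[of k l m n] dyadic_cube_mono[of l k n m]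
    by (cases "k \<le> l") (auto simp: Int_commute)
qed

lemma bounded_dyadic_cube:
  fixes m :: "int ^ 'n"
  shows "bounded (dyadic_cube k m)"
proof -
  let ?a = "(\<chi> i. 2 powi k * real_of_int (m $ i)) :: real ^ 'n"
  let ?b = "(\<chi> i. 2 powi k * (real_of_int (m $ i) + 1)) :: real ^ 'n"
  have "dyadic_cube k m \<subseteq> cbox ?a ?b"
    by (auto simp: dyadic_cube_def mem_box_cart less_imp_le)
  then show ?thesis
    using bounded_cbox bounded_subset by blast
qed

section \<open>Finiteness on bounded sets and exhaustion by finite unions\<close>

lemma emeasure_compact_less_top:
  assumes "\<nu> \<in> locally_finite_borel_measures" and "compact K"
  shows "emeasure \<nu> K < \<infinity>"
proof -
  have sets: "sets \<nu> = sets borel"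
    and "\<forall>x. \<exists>U. open U \<and> x \<in> U \<and> emeasure \<nu> U < \<infinity>"
    using assms(1) by (auto simp: locally_finite_borel_measures_def)
  then obtain U where U: "open (U x)" "x \<in> U x" "emeasure \<nu> (U x) < \<infinity>" for x
    by metis
  have "K \<subseteq> (\<Union>x\<in>K. U x)"
    using U by blast
  then obtain F where F: "finite F" "K \<subseteq> (\<Union>x\<in>F. U x)"
    using compactE_image[OF assms(2)] U(1) by metis
  have "emeasure \<nu> K \<le> emeasure \<nu> (\<Union>x\<in>F. U x)"
    using F U by (intro emeasure_mono) (auto simp: sets)
  also have "\<dots> \<le> (\<Sum>x\<in>F. emeasure \<nu> (U x))"
    using F U by (intro emeasure_subadditive_finite) (auto simp: sets)
  also have "\<dots> < \<infinity>"
    using F U by (simp add: ennreal_sum_less_top)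
  finally show ?thesis .
qed

lemma emeasure_bounded_less_top:
  fixes A :: "'a::euclidean_space set"
  assumes "\<nu> \<in> locally_finite_borel_measures" and "bounded A"
  shows "emeasure \<nu> A < \<infinity>"
proof -
  have sets: "sets \<nu> = sets borel"
    using assms(1) by (auto simp: locally_finite_borel_measures_def)
  have "emeasure \<nu> A \<le> emeasure \<nu> (closure A)"
    by (intro emeasure_mono) (auto simp: sets closure_subset)
  also have "\<dots> < \<infinity>"
    using assms by (intro emeasure_compact_less_top) (auto simp: compact_closure)
  finally show ?thesis .
qed

text \<open>Continuity from below along an enumeration. It reduces both directions to finite
  families of cubes, where maximal cubes exist and unions are bounded.\<close>

lemma emeasure_Union_le_finite:
  assumes "countable C" and "C \<subseteq> sets M"
    and le: "\<And>F. finite F \<Longrightarrow> F \<subseteq> C \<Longrightarrow> emeasure M (\<Union>F) \<le> K"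
  shows "emeasure M (\<Union>C) \<le> K"
proof (cases "C = {}")
  case False
  \<comment> \<open>For finite \<open>C\<close> the enumeration repeats members, which does not
    affect the unions.\<close>
  define A where "A n = \<Union>(from_nat_into C ` {..<n})" for n
  have range: "range (from_nat_into C) = C"
    using False assms(1) by (rule range_from_nat_into)
  have "(\<Union>n. A n) = \<Union>(range (from_nat_into C))"
    by (force simp: A_def)
  then have "emeasure M (\<Union>C) = emeasure M (\<Union>n. A n)"
    by (simp add: range)
  also have "\<dots> = (SUP n. emeasure M (A n))"
  proof (rule SUP_emeasure_incseq[symmetric])
    show "range A \<subseteq> sets M"
      using range assms(2) by (auto simp: A_def)
    show "incseq A"
      by (force simp: A_def incseq_def)
  qed
  also have "\<dots> \<le> K"
    unfolding A_def using range by (intro SUP_least le) auto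
  finally show ?thesis .
qed simp

section \<open>Covering argument\<close>

text \<open>By nesting, the maximal members of \<open>F\<close> are pairwise disjoint, and by
  finiteness they cover \<open>\<Union>F\<close>. The hypothesis can thus be summed over them with
  no loss from overlaps.\<close>

lemma dyadic_covering_finite:
  fixes \<sigma> \<nu> :: "(real ^ 'n) measure"
  assumes "sets \<sigma> = sets borel" "sets \<nu> = sets borel"
    and F: "finite F" "F \<subseteq> dyadic_cubes"
    and le: "\<And>Q. Q \<in> F \<Longrightarrow> emeasure \<sigma> Q \<le> c * emeasure \<nu> Q"
  shows "emeasure \<sigma> (\<Union>F) \<le> c * emeasure \<nu> (\<Union>F)"
proof -
  define G where "G = {Q \<in> F. \<forall>P\<in>F. Q \<subseteq> P \<longrightarrow> P = Q}"
  have G: "finite G" "G \<subseteq> F"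
    using F by (auto simp: G_def)
  have "\<exists>P\<in>G. Q \<subseteq> P" if "Q \<in> F" for Q
    using finite_has_maximal2[OF F(1) that] by (auto simp: G_def)
  then have Un: "\<Union>F = \<Union>G"
    using G by blast
  have disj: "disjoint_family_on (\<lambda>Q. Q) G"
    unfolding disjoint_family_on_def
  proof (intro ballI impI)
    fix P Q assume "P \<in> G" "Q \<in> G" "P \<noteq> Q"
    then show "P \<inter> Q = {}"
      using dyadic_cubes_nested[of P Q] F by (auto simp: G_def)
  qed
  have sets: "G \<subseteq> sets borel"
    using G F borel_dyadic_cubes by blast
  have "emeasure \<sigma> (\<Union>G) = (\<Sum>Q\<in>G. emeasure \<sigma> Q)"
    using sum_emeasure[OF _ disj G(1), of \<sigma>] sets assms(1) by auto
  also have "\<dots> \<le> (\<Sum>Q\<in>G. c * emeasure \<nu> Q)"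
    using le G by (intro sum_mono) auto
  also have "\<dots> = c * emeasure \<nu> (\<Union>G)"
    using sum_emeasure[OF _ disj G(1), of \<nu>] sets assms(2) by (auto simp flip: sum_distrib_left)
  finally show ?thesis
    by (simp add: Un)
qed

lemma dyadic_covering:
  fixes \<sigma> \<nu> :: "(real ^ 'n) measure"
  assumes "sets \<sigma> = sets borel" "sets \<nu> = sets borel"
    and C: "C \<subseteq> dyadic_cubes"
    and le: "\<And>Q. Q \<in> C \<Longrightarrow> emeasure \<sigma> Q \<le> c * emeasure \<nu> Q"
  shows "emeasure \<sigma> (\<Union>C) \<le> c * emeasure \<nu> UNIV"
proof (rule emeasure_Union_le_finite)
  show "countable C"
    using C countable_dyadic_cubes countable_subset by blast
  show "C \<subseteq> sets \<sigma>"
    using C assms(1) borel_dyadic_cubes by blast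
  fix F assume F: "finite F" "F \<subseteq> C"
  have "emeasure \<sigma> (\<Union>F) \<le> c * emeasure \<nu> (\<Union>F)"
    using F C le by (intro dyadic_covering_finite[OF assms(1,2)]) auto
  also have "\<dots> \<le> c * emeasure \<nu> UNIV"
    by (intro mult_left_mono emeasure_mono) (auto simp: assms(2))
  finally show "emeasure \<sigma> (\<Union>F) \<le> c * emeasure \<nu> UNIV" .
qed

section \<open>Weak norms as superlevel estimates\<close>

text \<open>For finite \<open>m\<close> this is monotonicity of the \<open>r\<close>-th power. For
  \<open>m = \<infinity>\<close> both sides are false, since \<open>t > 0\<close> makes the left
  product infinite.\<close>

lemma ennreal_rpow_le_iff:
  assumes "t > 0" "r > 0" "A \<ge> 0"
  shows "ennreal t * ennreal_rpow m (1 / r) \<le> ennreal A \<longleftrightarrow> m \<le> ennreal ((A / t) powr r)"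
proof (cases m)
  case (real x)
  have "t * x powr (1 / r) \<le> A \<longleftrightarrow> x powr (1 / r) \<le> A / t"
    using assms by (simp add: field_simps)
  also have "\<dots> \<longleftrightarrow> (x powr (1 / r)) powr r \<le> (A / t) powr r"
    using assms by (meson divide_nonneg_pos leI not_le powr_ge_zero powr_less_mono2 powr_mono2 less_imp_le)
  also have "\<dots> \<longleftrightarrow> x \<le> (A / t) powr r"
    using assms real by (simp add: powr_powr)
  finally show ?thesis
    using real assms by (simp add: ennreal_rpow_def flip: ennreal_mult)
qed (use assms in \<open>simp add: ennreal_rpow_def ennreal_mult_top top_unique\<close>)

lemma weak_Lp_norm_le_iff:
  assumes "r > 0" "A \<ge> 0"
  shows "weak_Lp_norm r \<sigma> f \<le> ennreal A \<longleftrightarrow>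
    (\<forall>t>0. emeasure \<sigma> {x \<in> space \<sigma>. f x > ennreal t} \<le> ennreal ((A / t) powr r))"
  unfolding weak_Lp_norm_def SUP_le_iff using ennreal_rpow_le_iff[OF _ assms] by auto

lemma dyadic_maximal_superlevel:
  "{x. dyadic_maximal \<rho> \<nu> x > a} = \<Union>{Q \<in> dyadic_cubes. ennreal (\<rho> Q) * emeasure \<nu> Q > a}"
  by (auto simp: dyadic_maximal_def less_SUP_iff)

section \<open>From the weak-type inequality to the superlevel bound for
  \<open>\<sigma>\<close>\<close>

text \<open>Absorption: dividing by \<open>m powr q\<close> gives
  \<open>m powr (1 - q) \<le> c powr q\<close>. The division relies on \<open>m\<close> being a
  finite number, hence the later restriction to finite unions of cubes.\<close>

lemma le_powr_self_imp:
  fixes m c :: real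
  assumes "0 < q" "q < 1" "0 \<le> m" "0 \<le> c" "m \<le> (c * m) powr q"
  shows "m \<le> c powr (q / (1 - q))"
proof (cases "m = 0")
  case False
  then have m: "m > 0"
    using assms by simp
  have "m powr (1 - q) = m / m powr q"
    using m by (simp add: powr_diff)
  also have "\<dots> \<le> c powr q"
    using assms m by (simp add: powr_mult field_simps)
  finally have "(m powr (1 - q)) powr (1 / (1 - q)) \<le> (c powr q) powr (1 / (1 - q))"
    using assms by (intro powr_mono2) auto
  then show ?thesis
    using assms m by (simp add: powr_powr)
qed simp

lemma weak_type_imp_superlevel_bound:
  fixes \<sigma> :: "(real ^ 'n) measure"
  assumes \<sigma>: "\<sigma> \<in> locally_finite_borel_measures"
    and q: "0 < q" "q < 1" and "\<kappa> > 0"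
    and weak: "\<And>\<nu>. \<nu> \<in> locally_finite_borel_measures \<Longrightarrow>
      weak_Lp_norm q \<sigma> (dyadic_maximal \<rho> \<nu>) \<le> ennreal \<kappa> * emeasure \<nu> UNIV"
    and "t > 0"
  shows "emeasure \<sigma> {x. dyadic_maximal \<rho> \<sigma> x > ennreal t} \<le> ennreal ((\<kappa> / t) powr (q / (1 - q)))"
  unfolding dyadic_maximal_superlevel
proof (rule emeasure_Union_le_finite)
  let ?C = "{Q \<in> dyadic_cubes. ennreal t < ennreal (\<rho> Q) * emeasure \<sigma> Q}"
  have sets: "sets \<sigma> = sets borel"
    using \<sigma> by (simp add: locally_finite_borel_measures_def)
  have space: "space \<sigma> = UNIV"
    using sets_eq_imp_space_eq[OF sets] by simp
  show "countable ?C"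
    by (rule countable_subset[OF _ countable_dyadic_cubes]) auto
  show "?C \<subseteq> sets \<sigma>"
    using sets borel_dyadic_cubes by blast
  fix F assume F: "finite F" "F \<subseteq> ?C"
  define E where "E = \<Union>F"
  \<comment> \<open>A density realises the restriction to \<open>E\<close> while keeping all of
    space and its Borel sets, as membership in \<open>locally_finite_borel_measures\<close>
    demands.\<close>
  define \<nu> where "\<nu> = density \<sigma> (indicator E)"
  have E: "E \<in> sets \<sigma>"
    using F sets borel_dyadic_cubes by (auto simp: E_def)
  have \<nu>_eq: "emeasure \<nu> A = emeasure \<sigma> (E \<inter> A)" if "A \<in> sets \<sigma>" for A
    using E that by (simp add: \<nu>_def emeasure_density nn_integral_indicator flip: indicator_inter_arith)
  have "bounded E"
    unfolding E_def using F by (intro bounded_Union) (auto simp: dyadic_cubes_def bounded_dyadic_cube)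
  then have fin: "emeasure \<sigma> E < \<infinity>"
    by (rule emeasure_bounded_less_top[OF \<sigma>])
  then obtain m where m: "m \<ge> 0" "emeasure \<sigma> E = ennreal m"
    by (cases "emeasure \<sigma> E") auto
  have mass: "emeasure \<nu> UNIV = ennreal m"
    using \<nu>_eq[of UNIV] m sets by simp
  \<comment> \<open>The total mass is finite, so the whole space serves as the neighbourhood of
    every point.\<close>
  have \<nu>: "\<nu> \<in> locally_finite_borel_measures"
    unfolding locally_finite_borel_measures_def
    using mass sets by (auto simp: \<nu>_def intro!: exI[of _ UNIV])
  have "E \<subseteq> {x. dyadic_maximal \<rho> \<nu> x > ennreal t}"
  proof -
    \<comment> \<open>Each cube of \<open>F\<close> lies inside \<open>E\<close>, so it still
      witnesses a value above \<open>t\<close> after the restriction.\<close>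
    have "emeasure \<nu> Q = emeasure \<sigma> Q" if "Q \<in> F" for Q
      using that F sets \<nu>_eq[of Q] borel_dyadic_cubes[of Q] by (auto simp: E_def Int_absorb1 Sup_upper)
    then show ?thesis
      unfolding dyadic_maximal_superlevel E_def using F by (intro Union_mono) auto
  qed
  then have "emeasure \<sigma> E \<le> emeasure \<sigma> {x \<in> space \<sigma>. dyadic_maximal \<rho> \<nu> x > ennreal t}"
    using borel_measurable_dyadic_maximal[of \<rho> \<nu>] by (intro emeasure_mono) (auto simp: sets space)
  also have "\<dots> \<le> ennreal ((\<kappa> * m / t) powr q)"
  proof -
    have "weak_Lp_norm q \<sigma> (dyadic_maximal \<rho> \<nu>) \<le> ennreal (\<kappa> * m)"
      using weak[OF \<nu>] \<open>\<kappa> > 0\<close> m by (simp add: mass ennreal_mult)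
    then show ?thesis
      using weak_Lp_norm_le_iff[of q "\<kappa> * m" \<sigma> "dyadic_maximal \<rho> \<nu>"] q m \<open>\<kappa> > 0\<close> \<open>t > 0\<close> by simp
  qed
  finally have "m \<le> (\<kappa> / t * m) powr q"
    by (simp add: m)
  then have "m \<le> (\<kappa> / t) powr (q / (1 - q))"
    using q m \<open>\<kappa> > 0\<close> \<open>t > 0\<close> by (intro le_powr_self_imp) auto
  then show "emeasure \<sigma> (\<Union>F) \<le> ennreal ((\<kappa> / t) powr (q / (1 - q)))"
    using m by (simp add: E_def)
qed

section \<open>From the superlevel bound for \<open>\<sigma>\<close> to the weak-type
  inequality\<close>

lemma dyadic_maximal_superlevel_split:
  fixes \<sigma> \<nu> :: "(real ^ 'n) measure"
  assumes sets: "sets \<sigma> = sets borel" "sets \<nu> = sets borel"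
    and \<rho>: "\<forall>Q \<in> dyadic_cubes. 0 \<le> \<rho> Q" and "s > 0" "t > 0"
  shows "emeasure \<sigma> {x. dyadic_maximal \<rho> \<nu> x > ennreal t}
    \<le> emeasure \<sigma> {x. dyadic_maximal \<rho> \<sigma> x > ennreal s} + ennreal (s / t) * emeasure \<nu> UNIV"
proof -
  let ?S = "{x. dyadic_maximal \<rho> \<sigma> x > ennreal s}"
  define C where "C = {Q \<in> dyadic_cubes. emeasure \<sigma> Q \<le> ennreal (s / t) * emeasure \<nu> Q}"
  have C: "C \<subseteq> sets borel" "countable C"
    using borel_dyadic_cubes countable_subset[OF _ countable_dyadic_cubes, of C]
    by (auto simp: C_def)
  have "Q \<subseteq> ?S \<union> \<Union>C" if Q: "Q \<in> dyadic_cubes" "ennreal t < ennreal (\<rho> Q) * emeasure \<nu> Q" for Q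
  proof (cases "ennreal s < ennreal (\<rho> Q) * emeasure \<sigma> Q")
    case True
    then show ?thesis
      using Q(1) unfolding dyadic_maximal_superlevel by auto
  next
    case False
    \<comment> \<open>Positivity of the finite weight \<open>\<rho> Q\<close> is what permits
      cancelling it in \<open>ennreal\<close> below.\<close>
    have "\<rho> Q \<noteq> 0"
      using Q(2) by (intro notI) simp
    then have pos: "\<rho> Q > 0"
      using \<rho> Q(1) by force
    have "ennreal (\<rho> Q) * emeasure \<sigma> Q \<le> ennreal s"
      using False by simp
    also have "\<dots> = ennreal (s / t) * ennreal t"
      using \<open>s > 0\<close> \<open>t > 0\<close> by (simp flip: ennreal_mult)
    also have "\<dots> \<le> ennreal (s / t) * (ennreal (\<rho> Q) * emeasure \<nu> Q)"
      using Q(2) by (intro mult_left_mono) auto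
    also have "\<dots> = ennreal (\<rho> Q) * (ennreal (s / t) * emeasure \<nu> Q)"
      by (simp add: mult_ac)
    finally have "emeasure \<sigma> Q \<le> ennreal (s / t) * emeasure \<nu> Q"
      using pos by (simp add: ennreal_mult_le_mult_iff)
    then show ?thesis
      using Q(1) by (auto simp: C_def)
  qed
  then have sub: "{x. dyadic_maximal \<rho> \<nu> x > ennreal t} \<subseteq> ?S \<union> \<Union>C"
    unfolding dyadic_maximal_superlevel[of t] dyadic_maximal_superlevel[of "ennreal t" \<rho> \<nu>] by blast
  have S: "?S \<in> sets \<sigma>"
    using borel_measurable_dyadic_maximal[of \<rho> \<sigma>] by (simp add: sets)
  have UC: "\<Union>C \<in> sets \<sigma>"
    using C by (auto simp: sets intro!: sets.countable_Union)
  have "emeasure \<sigma> {x. dyadic_maximal \<rho> \<nu> x > ennreal t} \<le> emeasure \<sigma> (?S \<union> \<Union>C)"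
    using sub S UC by (intro emeasure_mono) auto
  also have "\<dots> \<le> emeasure \<sigma> ?S + emeasure \<sigma> (\<Union>C)"
    using S UC by (rule emeasure_subadditive)
  also have "emeasure \<sigma> (\<Union>C) \<le> ennreal (s / t) * emeasure \<nu> UNIV"
    by (intro dyadic_covering sets) (auto simp: C_def)
  finally show ?thesis
    by (simp add: add_left_mono)
qed

text \<open>With \<open>N\<close> the mass of \<open>\<nu>\<close>, the splitting bounds the
  superlevel set by \<open>(A / s) powr (q / (1 - q)) + s / t * N\<close>. Balancing the two terms
  in \<open>s\<close> gives \<open>2 * w powr q\<close> with \<open>w = A * N / t\<close>; moving
  the 2 inside the power produces the factor \<open>2 powr (1 / q)\<close>.\<close>

lemma superlevel_bound_imp_weak_type:
  fixes \<sigma> \<nu> :: "(real ^ 'n) measure"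
  assumes sets: "sets \<sigma> = sets borel" "sets \<nu> = sets borel"
    and \<rho>: "\<forall>Q \<in> dyadic_cubes. 0 \<le> \<rho> Q"
    and q: "0 < q" "q < 1" and "A > 0"
    and bound: "\<And>s. s > 0 \<Longrightarrow> emeasure \<sigma> {x. dyadic_maximal \<rho> \<sigma> x > ennreal s}
      \<le> ennreal ((A / s) powr (q / (1 - q)))"
  shows "weak_Lp_norm q \<sigma> (dyadic_maximal \<rho> \<nu>) \<le> ennreal (2 powr (1 / q) * A) * emeasure \<nu> UNIV"
proof -
  have space: "space \<sigma> = UNIV"
    using sets_eq_imp_space_eq[OF sets(1)] by simp
  \<comment> \<open>Infinite mass makes the right side infinite, and zero mass makes the maximal
    function vanish. Both are set apart because the balancing \<open>s\<close> is positive only for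
    a positive finite \<open>N\<close>.\<close>
  consider "emeasure \<nu> UNIV = \<infinity>" | "emeasure \<nu> UNIV = 0"
    | N where "N > 0" "emeasure \<nu> UNIV = ennreal N"
    by (cases "emeasure \<nu> UNIV") (force simp: less_le)+
  then show ?thesis
  proof cases
    case 1
    then show ?thesis
      using \<open>A > 0\<close> by (simp add: ennreal_mult_top)
  next
    case 2
    have "emeasure \<nu> Q = 0" for Q
      using emeasure_space[of \<nu> Q] 2 sets_eq_imp_space_eq[OF sets(2)] by simp
    then have "dyadic_maximal \<rho> \<nu> = (\<lambda>x. 0)"
      by (auto simp: dyadic_maximal_def fun_eq_iff intro!: antisym SUP_least)
    then show ?thesis
      by (simp add: weak_Lp_norm_def ennreal_rpow_def)
  next
    case (3 N)
    have "emeasure \<sigma> {x. dyadic_maximal \<rho> \<nu> x > ennreal t}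
      \<le> ennreal ((2 powr (1 / q) * A * N / t) powr q)" if "t > 0" for t
    proof -
      define w where "w = A * N / t"
      define s where "s = A * w powr (q - 1)"
      have w: "w > 0" and s: "s > 0"
        using \<open>A > 0\<close> 3 that by (auto simp: w_def s_def)
      \<comment> \<open>this value of \<open>s\<close> makes both terms of the splitting equal to \<open>w powr q\<close>\<close>
      have "A / s = w powr (1 - q)"
        using \<open>A > 0\<close> w by (simp add: s_def powr_diff)
      then have first: "(A / s) powr (q / (1 - q)) = w powr q"
        using q by (simp add: powr_powr)
      have "s / t * N = w * w powr (q - 1)"
        by (simp add: s_def w_def)
      also have "\<dots> = w powr q"
        using w by (simp add: powr_diff)
      finally have second: "s / t * N = w powr q" .
      have "(2 powr (1 / q) * A * N / t) powr q = (2 powr (1 / q) * w) powr q"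
        by (simp add: w_def mult.assoc)
      also have "\<dots> = 2 * w powr q"
        using q w by (simp add: powr_mult powr_powr)
      finally have target: "(2 powr (1 / q) * A * N / t) powr q = 2 * w powr q" .
      have "emeasure \<sigma> {x. dyadic_maximal \<rho> \<nu> x > ennreal t}
        \<le> emeasure \<sigma> {x. dyadic_maximal \<rho> \<sigma> x > ennreal s} + ennreal (s / t) * emeasure \<nu> UNIV"
        using s that by (intro dyadic_maximal_superlevel_split sets \<rho>)
      also have "\<dots> \<le> ennreal ((A / s) powr (q / (1 - q))) + ennreal (s / t) * ennreal N"
        using bound[OF s] 3 by (simp add: add_right_mono)
      also have "ennreal (s / t) * ennreal N = ennreal (s / t * N)"
        using s that 3 by (intro ennreal_mult[symmetric]) auto
      also have "ennreal ((A / s) powr (q / (1 - q))) + ennreal (s / t * N) = ennreal (2 * w powr q)"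
        unfolding first second by (simp flip: ennreal_plus)
      finally show ?thesis
        unfolding target .
    qed
    then have "weak_Lp_norm q \<sigma> (dyadic_maximal \<rho> \<nu>) \<le> ennreal (2 powr (1 / q) * A * N)"
      using q \<open>A > 0\<close> 3 by (subst weak_Lp_norm_le_iff) (auto simp: space)
    also have "\<dots> = ennreal (2 powr (1 / q) * A) * emeasure \<nu> UNIV"
      using \<open>A > 0\<close> 3 by (simp add: ennreal_mult)
    finally show ?thesis .
  qed
qed

theorem theorem3p4:
  fixes \<sigma> :: "(real ^ 'n) measure"
    and q :: real
    and \<rho> :: "(real ^ 'n) set \<Rightarrow> real"
  assumes "\<sigma> \<in> locally_finite_borel_measures"
    and "0 < q" and "q < 1"
    and "\<forall>Q \<in> dyadic_cubes. 0 \<le> \<rho> Q"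
  shows "(\<exists>\<kappa>::real. \<kappa> > 0 \<and> (\<forall>\<nu> \<in> locally_finite_borel_measures.
             weak_Lp_norm q \<sigma> (dyadic_maximal \<rho> \<nu>) \<le> ennreal \<kappa> * emeasure \<nu> UNIV))
         \<longleftrightarrow> dyadic_maximal \<rho> \<sigma> \<in> weak_Lp (q / (1 - q)) \<sigma>"
proof -
  let ?p = "q / (1 - q)"
  have p: "?p > 0"
    using assms by simp
  have sets: "sets \<sigma> = sets borel"
    using assms(1) by (simp add: locally_finite_borel_measures_def)
  have space: "space \<sigma> = UNIV"
    using sets_eq_imp_space_eq[OF sets] by simp
  show ?thesis
  proof
    assume "\<exists>\<kappa>::real. \<kappa> > 0 \<and> (\<forall>\<nu> \<in> locally_finite_borel_measures.
      weak_Lp_norm q \<sigma> (dyadic_maximal \<rho> \<nu>) \<le> ennreal \<kappa> * emeasure \<nu> UNIV)"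
    then obtain \<kappa> where \<kappa>: "\<kappa> > 0" "\<And>\<nu>. \<nu> \<in> locally_finite_borel_measures \<Longrightarrow>
      weak_Lp_norm q \<sigma> (dyadic_maximal \<rho> \<nu>) \<le> ennreal \<kappa> * emeasure \<nu> UNIV"
      by blast
    \<comment> \<open>The superlevel bounds for all \<open>t\<close> are exactly this norm bound, so
      the constant \<open>\<kappa>\<close> carries over unchanged.\<close>
    have "weak_Lp_norm ?p \<sigma> (dyadic_maximal \<rho> \<sigma>) \<le> ennreal \<kappa>"
      using weak_type_imp_superlevel_bound[OF assms(1-3) \<kappa>] p \<kappa>(1)
      by (subst weak_Lp_norm_le_iff) (auto simp: space)
    then have "weak_Lp_norm ?p \<sigma> (dyadic_maximal \<rho> \<sigma>) < \<infinity>"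
      using ennreal_less_top le_less_trans by fastforce
    moreover have "dyadic_maximal \<rho> \<sigma> \<in> borel_measurable \<sigma>"
      using borel_measurable_dyadic_maximal measurable_cong_sets[OF sets refl] by blast
    ultimately show "dyadic_maximal \<rho> \<sigma> \<in> weak_Lp ?p \<sigma>"
      by (simp add: weak_Lp_def)
  next
    assume "dyadic_maximal \<rho> \<sigma> \<in> weak_Lp ?p \<sigma>"
    then obtain B where B: "B \<ge> 0" "weak_Lp_norm ?p \<sigma> (dyadic_maximal \<rho> \<sigma>) = ennreal B"
      by (cases "weak_Lp_norm ?p \<sigma> (dyadic_maximal \<rho> \<sigma>)") (auto simp: weak_Lp_def)
    \<comment> \<open>The norm \<open>B\<close> may be 0, whereas \<open>\<kappa>\<close> and the
      balancing \<open>s\<close> must be positive.\<close>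
    define A where "A = B + 1"
    have A: "A > 0" "weak_Lp_norm ?p \<sigma> (dyadic_maximal \<rho> \<sigma>) \<le> ennreal A"
      using B by (auto simp: A_def)
    have bound: "emeasure \<sigma> {x. dyadic_maximal \<rho> \<sigma> x > ennreal s} \<le> ennreal ((A / s) powr ?p)"
      if "s > 0" for s
      using A that p weak_Lp_norm_le_iff[of ?p A \<sigma> "dyadic_maximal \<rho> \<sigma>"] by (simp add: space)
    show "\<exists>\<kappa>::real. \<kappa> > 0 \<and> (\<forall>\<nu> \<in> locally_finite_borel_measures.
      weak_Lp_norm q \<sigma> (dyadic_maximal \<rho> \<nu>) \<le> ennreal \<kappa> * emeasure \<nu> UNIV)"
    proof (intro exI conjI ballI)
      show "2 powr (1 / q) * A > 0"
        using A by simp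
      fix \<nu> :: "(real ^ 'n) measure" assume "\<nu> \<in> locally_finite_borel_measures"
      then show "weak_Lp_norm q \<sigma> (dyadic_maximal \<rho> \<nu>)
          \<le> ennreal (2 powr (1 / q) * A) * emeasure \<nu> UNIV"
        using superlevel_bound_imp_weak_type[OF sets _ assms(4,2,3) A(1) bound]
        by (simp add: locally_finite_borel_measures_def)
    qed
  qed
qed

end
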